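(* Let $F^\tau G$ be a twisted group algebra of a locally finite group $G$ over a field $F$ of characteristic $0$, associated with the twisting function $\tau$. If all additive commutators of $F^\tau G$ belong to the center $Z(F^\tau G)$ of $F^\tau G$, then $F^\tau G$ is commutative.
   Context: Let $F$ be a field and $G$ a multiplicative group. The twisted group algebra $F^\tau G$ is a unital associative $F$-algebra with $F$-basis $\overline{G}=\{\overline{g}\mid g\in G\}$, a formal copy of $G$, with multiplication determined by $\overline{x}\,\overline{y}=\tau(x,y)\,\overline{xy}$ for all $x,y\in G$, where $\tau:G\times G\to F\setminus\{0\}$ is the twisting function (such that the resulting algebra is associative and unital). A group is locally finite if every finitely generated subgroup is finite. An additive commutator of an algebra $A$ is an element $ab-ba$ with $a,b\in A$. *)

theory Defs
  imports "HOL-Algebra.Module" "HOL-Algebra.Generated_Groups"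
begin

section \<open>Twisted group algebras\<close>

definition supp :: "('f, 'm) ring_scheme \<Rightarrow> ('g \<Rightarrow> 'f) \<Rightarrow> 'g set"
  where "supp F a = {x. a x \<noteq> \<zero>\<^bsub>F\<^esub>}"

definition basis_elt :: "('f, 'm) ring_scheme \<Rightarrow> 'g \<Rightarrow> 'g \<Rightarrow> 'f"
  where "basis_elt F g = (\<lambda>x. if x = g then \<one>\<^bsub>F\<^esub> else \<zero>\<^bsub>F\<^esub>)"

text \<open>The formal sum of all \<open>a g \<cdot> basis_elt F g\<close> is encoded by its coefficient function \<open>a\<close>, which
  is zero outside a finite subset of \<open>carrier G\<close>.  The product is the bilinear extension of
  \<open>basis_elt F x \<otimes> basis_elt F y = \<tau> x y \<odot> basis_elt F (x \<otimes>\<^bsub>G\<^esub> y)\<close>.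

  The basis vector of the identity of \<open>G\<close> need not be the identity of the algebra, as
  \<open>\<tau> \<one>\<^bsub>G\<^esub> \<one>\<^bsub>G\<^esub>\<close> may differ from 1.  But if the algebra has an identity at all (and is associative),
  it is the multiple of that vector by the inverse of \<open>\<tau> \<one>\<^bsub>G\<^esub> \<one>\<^bsub>G\<^esub>\<close>, as \<open>unit_unique\<close> below shows.\<close>

definition twisted_group_algebra ::
  "('f, 'm) ring_scheme \<Rightarrow> ('g, 'n) monoid_scheme \<Rightarrow> ('g \<Rightarrow> 'g \<Rightarrow> 'f) \<Rightarrow> ('f, 'g \<Rightarrow> 'f) module"
  where "twisted_group_algebra F G \<tau> =
    \<lparr>carrier = {a. range a \<subseteq> carrier F \<and> finite (supp F a) \<and> supp F a \<subseteq> carrier G},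
     monoid.mult = (\<lambda>a b z. finsum F (\<lambda>(x, y). a x \<otimes>\<^bsub>F\<^esub> b y \<otimes>\<^bsub>F\<^esub> \<tau> x y)
                {(x, y) \<in> supp F a \<times> supp F b. x \<otimes>\<^bsub>G\<^esub> y = z}),
     monoid.one = (\<lambda>x. inv\<^bsub>F\<^esub> (\<tau> \<one>\<^bsub>G\<^esub> \<one>\<^bsub>G\<^esub>) \<otimes>\<^bsub>F\<^esub> basis_elt F \<one>\<^bsub>G\<^esub> x),
     ring.zero = (\<lambda>x. \<zero>\<^bsub>F\<^esub>),
     ring.add = (\<lambda>a b x. a x \<oplus>\<^bsub>F\<^esub> b x),
     smult = (\<lambda>c a x. c \<otimes>\<^bsub>F\<^esub> a x)\<rparr>"

text \<open>\<open>monoid\<close> is exactly associativity and unitality; the remaining axioms of a unital associative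
  algebra hold for every nonzero \<open>\<tau>\<close> (\<open>ring\<close>, \<open>module\<close>, \<open>smult_mult_left\<close> and \<open>smult_mult_right\<close>
  below).\<close>

definition twisting_function ::
  "('f, 'm) ring_scheme \<Rightarrow> ('g, 'n) monoid_scheme \<Rightarrow> ('g \<Rightarrow> 'g \<Rightarrow> 'f) \<Rightarrow> bool"
  where "twisting_function F G \<tau> \<longleftrightarrow>
    (\<forall>x\<in>carrier G. \<forall>y\<in>carrier G. \<tau> x y \<in> carrier F - {\<zero>\<^bsub>F\<^esub>}) \<and>
    monoid (twisted_group_algebra F G \<tau>)"

section \<open>Characteristic zero, local finiteness, commutators, centre\<close>

definition char_zero :: "('f, 'm) ring_scheme \<Rightarrow> bool"
  where "char_zero F \<longleftrightarrow> (\<forall>n::nat. n > 0 \<longrightarrow> [n] \<cdot>\<^bsub>F\<^esub> \<one>\<^bsub>F\<^esub> \<noteq> \<zero>\<^bsub>F\<^esub>)"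

definition locally_finite :: "('g, 'n) monoid_scheme \<Rightarrow> bool"
  where "locally_finite G \<longleftrightarrow> (\<forall>S. finite S \<and> S \<subseteq> carrier G \<longrightarrow> finite (generate G S))"

definition additive_commutator :: "('a, 'm) ring_scheme \<Rightarrow> 'a \<Rightarrow> 'a \<Rightarrow> 'a"
  where "additive_commutator A a b = (a \<otimes>\<^bsub>A\<^esub> b) \<ominus>\<^bsub>A\<^esub> (b \<otimes>\<^bsub>A\<^esub> a)"

definition center :: "('a, 'm) monoid_scheme \<Rightarrow> 'a set"
  where "center A = {z \<in> carrier A. \<forall>x\<in>carrier A. z \<otimes>\<^bsub>A\<^esub> x = x \<otimes>\<^bsub>A\<^esub> z}"

section \<open>The algebra structure\<close>

locale nonzero_twist = F?: field F + G: group G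
  for F (structure) and G :: "('g, 'n) monoid_scheme" and \<tau> +
  assumes \<tau>: "\<And>x y. x \<in> carrier G \<Longrightarrow> y \<in> carrier G \<Longrightarrow> \<tau> x y \<in> carrier F - {\<zero>}"
begin

abbreviation A where "A \<equiv> twisted_group_algebra F G \<tau>"

lemma carrierD:
  assumes "a \<in> carrier A"
  shows "a x \<in> carrier F" "finite (supp F a)" "supp F a \<subseteq> carrier G"
  using assms by (auto simp: twisted_group_algebra_def)

lemma carrierI:
  assumes "\<And>x. a x \<in> carrier F" "finite S" "S \<subseteq> carrier G" "\<And>x. x \<notin> S \<Longrightarrow> a x = \<zero>"
  shows "a \<in> carrier A"
proof -
  have "supp F a \<subseteq> S" using assms(4) by (auto simp: supp_def)
  thus ?thesis using assms(1-3)
    by (auto simp: twisted_group_algebra_def intro: finite_subset)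
qed

lemma ops:
  "(a \<otimes>\<^bsub>A\<^esub> b) z = (\<Oplus>p \<in> {(x, y) \<in> supp F a \<times> supp F b. x \<otimes>\<^bsub>G\<^esub> y = z}. case p of (x, y) \<Rightarrow> a x \<otimes> b y \<otimes> \<tau> x y)"
  "\<one>\<^bsub>A\<^esub> z = inv (\<tau> \<one>\<^bsub>G\<^esub> \<one>\<^bsub>G\<^esub>) \<otimes> basis_elt F \<one>\<^bsub>G\<^esub> z"
  "\<zero>\<^bsub>A\<^esub> z = \<zero>" "(a \<oplus>\<^bsub>A\<^esub> b) z = a z \<oplus> b z" "(c \<odot>\<^bsub>A\<^esub> a) z = c \<otimes> a z"
  by (auto simp: twisted_group_algebra_def)

lemma add_closed: "a \<in> carrier A \<Longrightarrow> b \<in> carrier A \<Longrightarrow> a \<oplus>\<^bsub>A\<^esub> b \<in> carrier A"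
  by (rule carrierI[where S = "supp F a \<union> supp F b"])
     (auto simp: ops supp_def dest: carrierD[unfolded supp_def])

lemma zero_closed: "\<zero>\<^bsub>A\<^esub> \<in> carrier A"
  by (rule carrierI[where S = "{}"]) (auto simp: ops)

lemma smult_closed: "c \<in> carrier F \<Longrightarrow> a \<in> carrier A \<Longrightarrow> c \<odot>\<^bsub>A\<^esub> a \<in> carrier A"
  by (rule carrierI[where S = "supp F a"]) (auto simp: ops supp_def dest: carrierD[unfolded supp_def])

lemma basis_closed: "g \<in> carrier G \<Longrightarrow> basis_elt F g \<in> carrier A"
  by (rule carrierI[where S = "{g}"]) (auto simp: basis_elt_def)

lemma add_group: "abelian_group A"
proof (rule abelian_groupI)
  fix a assume a: "a \<in> carrier A"
  have "(\<lambda>x. \<ominus> a x) \<in> carrier A"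
    by (rule carrierI[where S = "supp F a"]) (use a in \<open>auto simp: supp_def dest: carrierD[unfolded supp_def]\<close>)
  moreover have "(\<lambda>x. \<ominus> a x) \<oplus>\<^bsub>A\<^esub> a = \<zero>\<^bsub>A\<^esub>"
    by (rule ext) (simp add: ops carrierD[OF a] F.l_neg)
  ultimately show "\<exists>b\<in>carrier A. b \<oplus>\<^bsub>A\<^esub> a = \<zero>\<^bsub>A\<^esub>" by blast
qed (auto simp: fun_eq_iff ops add_closed zero_closed carrierD F.a_ac)

lemma module: "module F A"
  by (rule moduleI)
     (auto simp: fun_eq_iff ops add_group smult_closed carrierD F.is_cring F.l_distr F.r_distr F.m_assoc)

lemma mult_eq:
  assumes a: "a \<in> carrier A" and b: "b \<in> carrier A"
    and S: "finite S" "supp F a \<subseteq> S" "S \<subseteq> carrier G"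
    and T: "finite T" "supp F b \<subseteq> T" "T \<subseteq> carrier G"
  shows "(a \<otimes>\<^bsub>A\<^esub> b) z = (\<Oplus>p \<in> {(x, y) \<in> S \<times> T. x \<otimes>\<^bsub>G\<^esub> y = z}. case p of (x, y) \<Rightarrow> a x \<otimes> b y \<otimes> \<tau> x y)"
  unfolding ops(1)
proof (rule F.add.finprod_mono_neutral_cong_left)
  show "finite {(x, y) \<in> S \<times> T. x \<otimes>\<^bsub>G\<^esub> y = z}"
    by (rule finite_subset[of _ "S \<times> T"]) (use S T in auto)
next
  fix p assume "p \<in> {(x, y) \<in> S \<times> T. x \<otimes>\<^bsub>G\<^esub> y = z} - {(x, y) \<in> supp F a \<times> supp F b. x \<otimes>\<^bsub>G\<^esub> y = z}"
  then obtain x y where p: "p = (x, y)" "x \<in> S" "y \<in> T" "a x = \<zero> \<or> b y = \<zero>"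
    by (auto simp: supp_def)
  hence "x \<in> carrier G" "y \<in> carrier G" using S T by auto
  show "(case p of (x, y) \<Rightarrow> a x \<otimes> b y \<otimes> \<tau> x y) = \<zero>"
    using p \<open>x \<in> carrier G\<close> \<open>y \<in> carrier G\<close> \<tau>[of x y] carrierD(1)[OF a] carrierD(1)[OF b] by auto
next
  have "\<tau> x y \<in> carrier F" if "x \<in> S" "y \<in> T" for x y using \<tau> S T that by blast
  thus "(\<lambda>(x, y). a x \<otimes> b y \<otimes> \<tau> x y) \<in> {(x, y) \<in> S \<times> T. x \<otimes>\<^bsub>G\<^esub> y = z} \<rightarrow> carrier F"
    using carrierD(1)[OF a] carrierD(1)[OF b] by auto
qed (use S T in auto)

lemma mult_closed:
  assumes a: "a \<in> carrier A" and b: "b \<in> carrier A"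
  shows "a \<otimes>\<^bsub>A\<^esub> b \<in> carrier A"
proof (rule carrierI)
  let ?S = "(\<lambda>(x, y). x \<otimes>\<^bsub>G\<^esub> y) ` (supp F a \<times> supp F b)"
  have t: "\<tau> x y \<in> carrier F" if "x \<in> supp F a" "y \<in> supp F b" for x y
    using \<tau> carrierD(3)[OF a] carrierD(3)[OF b] that by blast
  show "finite ?S" using carrierD[OF a] carrierD[OF b] by auto
  show "?S \<subseteq> carrier G" using carrierD[OF a] carrierD[OF b] by auto
  show "(a \<otimes>\<^bsub>A\<^esub> b) z \<in> carrier F" for z
    unfolding ops(1)
    by (rule F.finsum_closed)
       (use t carrierD(1)[OF a] carrierD(1)[OF b] in auto)
  show "(a \<otimes>\<^bsub>A\<^esub> b) z = \<zero>" if "z \<notin> ?S" for z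
  proof -
    have "{(x, y) \<in> supp F a \<times> supp F b. x \<otimes>\<^bsub>G\<^esub> y = z} = {}" using that by auto
    thus ?thesis by (simp only: ops F.finsum_empty)
  qed
qed

lemma distrib:
  assumes a: "a \<in> carrier A" and b: "b \<in> carrier A" and c: "c \<in> carrier A"
  shows "(a \<oplus>\<^bsub>A\<^esub> b) \<otimes>\<^bsub>A\<^esub> c = (a \<otimes>\<^bsub>A\<^esub> c) \<oplus>\<^bsub>A\<^esub> (b \<otimes>\<^bsub>A\<^esub> c)"
    and "c \<otimes>\<^bsub>A\<^esub> (a \<oplus>\<^bsub>A\<^esub> b) = (c \<otimes>\<^bsub>A\<^esub> a) \<oplus>\<^bsub>A\<^esub> (c \<otimes>\<^bsub>A\<^esub> b)"
proof -
  let ?S = "supp F a \<union> supp F b" and ?T = "supp F c"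
  have ab: "supp F (a \<oplus>\<^bsub>A\<^esub> b) \<subseteq> ?S" by (auto simp: supp_def ops)
  note [simp] = carrierD[OF a] carrierD[OF b] carrierD[OF c]
  note eqs = mult_eq[OF add_closed[OF a b] c, of ?S ?T] mult_eq[OF a c, of ?S ?T] mult_eq[OF b c, of ?S ?T]
    mult_eq[OF c add_closed[OF a b], of ?T ?S] mult_eq[OF c a, of ?T ?S] mult_eq[OF c b, of ?T ?S]
  have S: "x \<in> ?S \<Longrightarrow> x \<in> carrier G" "x \<in> ?T \<Longrightarrow> x \<in> carrier G" for x
    using carrierD(3)[OF a] carrierD(3)[OF b] carrierD(3)[OF c] by blast+
  have t: "\<tau> x y \<in> carrier F" if "x \<in> ?S" "y \<in> ?T" for x y using \<tau> S that by blast
  have t': "\<tau> y x \<in> carrier F" if "x \<in> ?S" "y \<in> ?T" for x y using \<tau> S that by blast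
  show "(a \<oplus>\<^bsub>A\<^esub> b) \<otimes>\<^bsub>A\<^esub> c = (a \<otimes>\<^bsub>A\<^esub> c) \<oplus>\<^bsub>A\<^esub> (b \<otimes>\<^bsub>A\<^esub> c)"
  proof (rule ext)
    fix z
    let ?P = "{(x, y) \<in> ?S \<times> ?T. x \<otimes>\<^bsub>G\<^esub> y = z}"
    have "(\<Oplus>p \<in> ?P. case p of (x, y) \<Rightarrow> (a \<oplus>\<^bsub>A\<^esub> b) x \<otimes> c y \<otimes> \<tau> x y)
      = (\<Oplus>p \<in> ?P. (case p of (x, y) \<Rightarrow> a x \<otimes> c y \<otimes> \<tau> x y) \<oplus> (case p of (x, y) \<Rightarrow> b x \<otimes> c y \<otimes> \<tau> x y))"
      by (rule F.add.finprod_cong') (use t in \<open>auto simp: ops F.l_distr\<close>)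
    also have "\<dots> = (\<Oplus>p \<in> ?P. case p of (x, y) \<Rightarrow> a x \<otimes> c y \<otimes> \<tau> x y) \<oplus> (\<Oplus>p \<in> ?P. case p of (x, y) \<Rightarrow> b x \<otimes> c y \<otimes> \<tau> x y)"
      by (rule F.finsum_addf) (use t in auto)
    finally show "((a \<oplus>\<^bsub>A\<^esub> b) \<otimes>\<^bsub>A\<^esub> c) z = ((a \<otimes>\<^bsub>A\<^esub> c) \<oplus>\<^bsub>A\<^esub> (b \<otimes>\<^bsub>A\<^esub> c)) z"
      using ab S by (subst ops(4)) (simp add: eqs)
  qed
  show "c \<otimes>\<^bsub>A\<^esub> (a \<oplus>\<^bsub>A\<^esub> b) = (c \<otimes>\<^bsub>A\<^esub> a) \<oplus>\<^bsub>A\<^esub> (c \<otimes>\<^bsub>A\<^esub> b)"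
  proof (rule ext)
    fix z
    let ?P = "{(x, y) \<in> ?T \<times> ?S. x \<otimes>\<^bsub>G\<^esub> y = z}"
    have "(\<Oplus>p \<in> ?P. case p of (x, y) \<Rightarrow> c x \<otimes> (a \<oplus>\<^bsub>A\<^esub> b) y \<otimes> \<tau> x y)
      = (\<Oplus>p \<in> ?P. (case p of (x, y) \<Rightarrow> c x \<otimes> a y \<otimes> \<tau> x y) \<oplus> (case p of (x, y) \<Rightarrow> c x \<otimes> b y \<otimes> \<tau> x y))"
      by (rule F.add.finprod_cong') (use t' in \<open>auto simp: ops F.r_distr F.l_distr\<close>)
    also have "\<dots> = (\<Oplus>p \<in> ?P. case p of (x, y) \<Rightarrow> c x \<otimes> a y \<otimes> \<tau> x y) \<oplus> (\<Oplus>p \<in> ?P. case p of (x, y) \<Rightarrow> c x \<otimes> b y \<otimes> \<tau> x y)"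
      by (rule F.finsum_addf) (use t' in auto)
    finally show "(c \<otimes>\<^bsub>A\<^esub> (a \<oplus>\<^bsub>A\<^esub> b)) z = ((c \<otimes>\<^bsub>A\<^esub> a) \<oplus>\<^bsub>A\<^esub> (c \<otimes>\<^bsub>A\<^esub> b)) z"
      using ab S by (subst ops(4)) (simp add: eqs)
  qed
qed

lemma smult_mult:
  assumes k: "k \<in> carrier F" and a: "a \<in> carrier A" and b: "b \<in> carrier A"
  shows smult_mult_left: "(k \<odot>\<^bsub>A\<^esub> a) \<otimes>\<^bsub>A\<^esub> b = k \<odot>\<^bsub>A\<^esub> (a \<otimes>\<^bsub>A\<^esub> b)"
    and smult_mult_right: "a \<otimes>\<^bsub>A\<^esub> (k \<odot>\<^bsub>A\<^esub> b) = k \<odot>\<^bsub>A\<^esub> (a \<otimes>\<^bsub>A\<^esub> b)"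
proof -
  let ?S = "supp F a" and ?T = "supp F b"
  note [simp] = carrierD[OF a] carrierD[OF b] k
  have s: "supp F (k \<odot>\<^bsub>A\<^esub> a) \<subseteq> ?S" "supp F (k \<odot>\<^bsub>A\<^esub> b) \<subseteq> ?T" by (auto simp: supp_def ops)
  note eqs = mult_eq[OF smult_closed[OF k a] b, of ?S ?T] mult_eq[OF a smult_closed[OF k b], of ?S ?T]
    mult_eq[OF a b, of ?S ?T]
  have t: "\<tau> x y \<in> carrier F" if "x \<in> ?S" "y \<in> ?T" for x y
    using \<tau> carrierD(3)[OF a] carrierD(3)[OF b] that by blast
  have fin: "finite {(x, y) \<in> ?S \<times> ?T. x \<otimes>\<^bsub>G\<^esub> y = z}" for z
    by (rule finite_subset[of _ "?S \<times> ?T"]) auto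
  have *: "k \<otimes> (\<Oplus>p \<in> {(x, y) \<in> ?S \<times> ?T. x \<otimes>\<^bsub>G\<^esub> y = z}. case p of (x, y) \<Rightarrow> a x \<otimes> b y \<otimes> \<tau> x y)
      = (\<Oplus>p \<in> {(x, y) \<in> ?S \<times> ?T. x \<otimes>\<^bsub>G\<^esub> y = z}. k \<otimes> (case p of (x, y) \<Rightarrow> a x \<otimes> b y \<otimes> \<tau> x y))" for z
    by (rule F.finsum_rdistr) (use t fin in auto)
  show "(k \<odot>\<^bsub>A\<^esub> a) \<otimes>\<^bsub>A\<^esub> b = k \<odot>\<^bsub>A\<^esub> (a \<otimes>\<^bsub>A\<^esub> b)"
  proof (rule ext)
    fix z
    have "(\<Oplus>p \<in> {(x, y) \<in> ?S \<times> ?T. x \<otimes>\<^bsub>G\<^esub> y = z}. case p of (x, y) \<Rightarrow> (k \<odot>\<^bsub>A\<^esub> a) x \<otimes> b y \<otimes> \<tau> x y)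
      = (\<Oplus>p \<in> {(x, y) \<in> ?S \<times> ?T. x \<otimes>\<^bsub>G\<^esub> y = z}. k \<otimes> (case p of (x, y) \<Rightarrow> a x \<otimes> b y \<otimes> \<tau> x y))"
      by (rule F.add.finprod_cong') (use t in \<open>auto simp: ops F.m_ac\<close>)
    thus "((k \<odot>\<^bsub>A\<^esub> a) \<otimes>\<^bsub>A\<^esub> b) z = (k \<odot>\<^bsub>A\<^esub> (a \<otimes>\<^bsub>A\<^esub> b)) z"
      using s *[of z] by (subst ops(5)) (simp add: eqs)
  qed
  show "a \<otimes>\<^bsub>A\<^esub> (k \<odot>\<^bsub>A\<^esub> b) = k \<odot>\<^bsub>A\<^esub> (a \<otimes>\<^bsub>A\<^esub> b)"
  proof (rule ext)
    fix z
    have "(\<Oplus>p \<in> {(x, y) \<in> ?S \<times> ?T. x \<otimes>\<^bsub>G\<^esub> y = z}. case p of (x, y) \<Rightarrow> a x \<otimes> (k \<odot>\<^bsub>A\<^esub> b) y \<otimes> \<tau> x y)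
      = (\<Oplus>p \<in> {(x, y) \<in> ?S \<times> ?T. x \<otimes>\<^bsub>G\<^esub> y = z}. k \<otimes> (case p of (x, y) \<Rightarrow> a x \<otimes> b y \<otimes> \<tau> x y))"
      by (rule F.add.finprod_cong') (use t in \<open>auto simp: ops F.m_ac\<close>)
    thus "(a \<otimes>\<^bsub>A\<^esub> (k \<odot>\<^bsub>A\<^esub> b)) z = (k \<odot>\<^bsub>A\<^esub> (a \<otimes>\<^bsub>A\<^esub> b)) z"
      using s *[of z] by (subst ops(5)) (simp add: eqs)
  qed
qed

lemma basis_mult:
  assumes "x \<in> carrier G" "y \<in> carrier G"
  shows "basis_elt F x \<otimes>\<^bsub>A\<^esub> basis_elt F y = \<tau> x y \<odot>\<^bsub>A\<^esub> basis_elt F (x \<otimes>\<^bsub>G\<^esub> y)"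
proof (rule ext)
  fix z
  have s: "supp F (basis_elt F g) = {g}" for g :: 'g by (auto simp: supp_def basis_elt_def)
  have "{(u, v) \<in> {x} \<times> {y}. u \<otimes>\<^bsub>G\<^esub> v = z} = (if x \<otimes>\<^bsub>G\<^esub> y = z then {(x, y)} else {})" by auto
  thus "(basis_elt F x \<otimes>\<^bsub>A\<^esub> basis_elt F y) z = (\<tau> x y \<odot>\<^bsub>A\<^esub> basis_elt F (x \<otimes>\<^bsub>G\<^esub> y)) z"
    unfolding ops s using \<tau>[OF assms] by (auto simp: basis_elt_def)
qed

lemma ring: "monoid A \<Longrightarrow> ring A"
  by (rule ringI) (auto simp: add_group distrib)

lemma unit_unique:
  assumes assoc: "\<And>a b c. a \<in> carrier A \<Longrightarrow> b \<in> carrier A \<Longrightarrow> c \<in> carrier A \<Longrightarrow>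
      (a \<otimes>\<^bsub>A\<^esub> b) \<otimes>\<^bsub>A\<^esub> c = a \<otimes>\<^bsub>A\<^esub> (b \<otimes>\<^bsub>A\<^esub> c)"
    and e: "e \<in> carrier A" "\<And>a. a \<in> carrier A \<Longrightarrow> e \<otimes>\<^bsub>A\<^esub> a = a" "\<And>a. a \<in> carrier A \<Longrightarrow> a \<otimes>\<^bsub>A\<^esub> e = a"
  shows "e = \<one>\<^bsub>A\<^esub>"
proof -
  let ?u = "basis_elt F \<one>\<^bsub>G\<^esub>" and ?t = "\<tau> \<one>\<^bsub>G\<^esub> \<one>\<^bsub>G\<^esub>"
  have t: "?t \<in> carrier F" "?t \<noteq> \<zero>" using \<tau>[of "\<one>\<^bsub>G\<^esub>" "\<one>\<^bsub>G\<^esub>"] by auto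
  hence i: "inv ?t \<in> carrier F" "inv ?t \<otimes> ?t = \<one>" using F.field_Units by auto
  have u: "?u \<in> carrier A" by (rule basis_closed) simp
  have one: "\<one>\<^bsub>A\<^esub> = inv ?t \<odot>\<^bsub>A\<^esub> ?u" by (rule ext) (simp add: ops)
  \<comment> \<open>the coefficient of \<open>a \<otimes> ?u\<close> at \<open>z\<close> is \<open>a z \<otimes> \<tau> z 1\<close>\<close>
  have coeff: "(a \<otimes>\<^bsub>A\<^esub> ?u) z = a z \<otimes> \<tau> z \<one>\<^bsub>G\<^esub>" if a: "a \<in> carrier A" and z: "z \<in> carrier G" for a z
  proof -
    have su: "supp F ?u = {\<one>\<^bsub>G\<^esub>}" by (auto simp: supp_def basis_elt_def)
    have "(a \<otimes>\<^bsub>A\<^esub> ?u) z = (\<Oplus>p \<in> {(x, y) \<in> insert z (supp F a) \<times> {\<one>\<^bsub>G\<^esub>}. x \<otimes>\<^bsub>G\<^esub> y = z}. case p of (x, y) \<Rightarrow> a x \<otimes> ?u y \<otimes> \<tau> x y)"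
      by (rule mult_eq[OF a u]) (use carrierD[OF a] z su in auto)
    also have "{(x, y) \<in> insert z (supp F a) \<times> {\<one>\<^bsub>G\<^esub>}. x \<otimes>\<^bsub>G\<^esub> y = z} = {(z, \<one>\<^bsub>G\<^esub>)}"
      using carrierD(3)[OF a] z by auto
    finally show ?thesis
      using \<tau>[OF z, of "\<one>\<^bsub>G\<^esub>"] carrierD(1)[OF a] by (simp add: basis_elt_def)
  qed
  have ou: "\<one>\<^bsub>A\<^esub> \<otimes>\<^bsub>A\<^esub> ?u = ?u"
    using i t u by (simp add: one smult_mult_left basis_mult)
      (auto simp: fun_eq_iff ops basis_elt_def)
  have oc: "\<one>\<^bsub>A\<^esub> \<in> carrier A" unfolding one by (rule smult_closed) (use i u in auto)
  show ?thesis
  proof (rule ext)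
    fix z
    show "e z = \<one>\<^bsub>A\<^esub> z"
    proof (cases "z \<in> carrier G")
      case True
      have "e z \<otimes> \<tau> z \<one>\<^bsub>G\<^esub> = \<one>\<^bsub>A\<^esub> z \<otimes> \<tau> z \<one>\<^bsub>G\<^esub>"
        using coeff[OF e(1) True] coeff[OF oc True] ou e(2)[OF u] by simp
      thus ?thesis using \<tau>[OF True, of "\<one>\<^bsub>G\<^esub>"] carrierD(1)[OF e(1)] carrierD(1)[OF oc]
        F.m_rcancel[of "\<tau> z \<one>\<^bsub>G\<^esub>"] by auto
    next
      case False
      hence "z \<notin> supp F e" "z \<notin> supp F \<one>\<^bsub>A\<^esub>" using carrierD(3)[OF e(1)] carrierD(3)[OF oc] by blast+
      thus ?thesis by (simp add: supp_def)
    qed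
  qed
qed

end

end

theory Submission
  imports Defs "HOL-Algebra.Multiplicative_Group"
begin

text \<open>
  Write \<open>[a, b]\<close> for the additive commutator, and let \<open>x\<close> and \<open>y\<close> be basis vectors of the algebra
  \<open>A\<close>.  The commutator \<open>c = [x, y]\<close> is central, and so is \<open>[x, x y] = x c\<close>.  Hence
  \<open>0 = [x c, y] = c [x, y] = c\<^sup>2\<close>.

  The basis vectors are units.  Dividing \<open>c = x y - y x\<close> by \<open>y x\<close> therefore gives a unit
  \<open>w = x y (y x)\<^sup>-\<^sup>1\<close> with \<open>(w - 1)\<^sup>2 = 0\<close>, so that \<open>w\<^sup>n = 1 + n (w - 1)\<close> for all \<open>n\<close>
  (\<open>commutator_quotient_unipotent\<close>, \<open>one_plus_square_zero_pow\<close>).  On the other hand \<open>w\<close> is a scalar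
  multiple of the basis vector of a group commutator, which has some finite order \<open>n > 0\<close>, so \<open>w\<^sup>n\<close>
  is a scalar.  In characteristic 0 one can divide by \<open>n\<close>, so the square-zero element \<open>w - 1\<close> is
  itself a scalar and therefore 0 (\<open>unipotent_torsion_trivial\<close>).  Thus \<open>x y = y x\<close>, and
  commutativity of \<open>A\<close> follows by bilinearity.
\<close>

lemma (in group) locally_finite_torsion:
  assumes "locally_finite G" and k: "k \<in> carrier G"
  obtains n :: nat where "n > 0" "k [^] n = \<one>"
proof -
  let ?H = "G\<lparr>carrier := generate G {k}\<rparr>"
  have sub: "subgroup (generate G {k}) G" using k by (intro generate_is_subgroup) auto
  interpret H: group ?H by (rule subgroup.subgroup_is_group[OF sub]) (rule is_group)
  have "finite (carrier ?H)" using assms by (auto simp: locally_finite_def)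
  hence "order ?H > 0" using H.order_gt_0_iff_finite by blast
  moreover have "k [^]\<^bsub>?H\<^esub> order ?H = \<one>\<^bsub>?H\<^esub>"
    by (rule H.pow_order_eq_1) (auto intro: generate.incl)
  ultimately show thesis using that by (simp add: nat_pow_consistent[symmetric])
qed

context ring
begin

text \<open>Both \<open>c = [x, y]\<close> and \<open>x c = [x, x y]\<close> commute with \<open>y\<close>, so \<open>x y c = x c y = y x c\<close>, that is,
  \<open>c\<^sup>2 = 0\<close>.  As \<open>c\<close> is central, \<open>c v\<close> also has square zero.\<close>

lemma commutator_quotient_unipotent:
  assumes central: "\<And>a b. a \<in> carrier R \<Longrightarrow> b \<in> carrier R \<Longrightarrow> additive_commutator R a b \<in> center R"
    and x: "x \<in> carrier R" and y: "y \<in> carrier R"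
    and v: "v \<in> carrier R" "y \<otimes> x \<otimes> v = \<one>"
  shows "(x \<otimes> y \<otimes> v \<ominus> \<one>) \<otimes> (x \<otimes> y \<otimes> v \<ominus> \<one>) = \<zero>"
proof -
  define c where "c = additive_commutator R x y"
  have c: "c \<in> carrier R" and comm: "\<And>a. a \<in> carrier R \<Longrightarrow> c \<otimes> a = a \<otimes> c"
    using central[OF x y] by (auto simp: c_def center_def)
  have c_eq: "c = x \<otimes> y \<ominus> y \<otimes> x" by (simp add: c_def additive_commutator_def)
  have "x \<otimes> c = additive_commutator R x (x \<otimes> y)"
    using x y by (simp add: c_eq additive_commutator_def minus_eq r_distr r_minus m_assoc)
  hence "x \<otimes> c \<in> center R" using central x y by simp
  hence "x \<otimes> c \<otimes> y = y \<otimes> (x \<otimes> c)" using y by (simp add: center_def)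
  hence "x \<otimes> y \<otimes> c = y \<otimes> x \<otimes> c" using x y c comm[OF y] by (simp add: m_assoc)
  hence sq: "c \<otimes> c = \<zero>"
    using x y c by (subst (1) c_eq) (simp add: minus_eq l_distr l_minus r_neg)
  have w: "x \<otimes> y \<otimes> v \<ominus> \<one> = c \<otimes> v"
    using x y v by (simp add: c_eq minus_eq l_distr l_minus)
  have "c \<otimes> v \<otimes> (c \<otimes> v) = c \<otimes> (v \<otimes> c) \<otimes> v" using c v by (simp add: m_assoc)
  also have "\<dots> = c \<otimes> c \<otimes> (v \<otimes> v)"
    using c v by (subst comm[OF v(1), symmetric]) (simp add: m_assoc)
  finally have "c \<otimes> v \<otimes> (c \<otimes> v) = c \<otimes> c \<otimes> (v \<otimes> v)" .
  thus ?thesis using sq v by (simp add: w)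
qed

lemma one_plus_square_zero_pow:
  assumes e: "e \<in> carrier R" and sq: "e \<otimes> e = \<zero>"
  shows "(\<one> \<oplus> e) [^] (n::nat) = \<one> \<oplus> [n] \<cdot> e"
proof (induction n)
  case (Suc n)
  have "[n] \<cdot> e \<otimes> e = \<zero>" using add_pow_ldistr[OF e e, of n] sq by simp
  thus ?case using Suc e by (simp add: l_distr r_distr a_ac)
qed (simp add: e)

end

locale twisted_algebra = nonzero_twist F G \<tau>
  for F :: "('f, 'm) ring_scheme" (structure) and G :: "('g, 'n) monoid_scheme" and \<tau> +
  assumes monoid_A: "monoid (twisted_group_algebra F G \<tau>)"
begin

sublocale A: ring A by (rule ring) (rule monoid_A)
sublocale M: Module.module F A by (rule module)

text \<open>These lines grade the algebra by \<open>G\<close>: products and powers of multiples of basis vectors can be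
  located through the group alone, without keeping track of the values of \<open>\<tau>\<close>.\<close>

definition homogeneous :: "'g \<Rightarrow> ('g \<Rightarrow> 'f) set"
  where "homogeneous g = {l \<odot>\<^bsub>A\<^esub> basis_elt F g | l. l \<in> carrier F}"

lemma homogeneous_carrier: "g \<in> carrier G \<Longrightarrow> a \<in> homogeneous g \<Longrightarrow> a \<in> carrier A"
  by (auto simp: homogeneous_def smult_closed basis_closed)

lemma basis_homogeneous: "g \<in> carrier G \<Longrightarrow> basis_elt F g \<in> homogeneous g"
  unfolding homogeneous_def using M.smult_one[OF basis_closed, of g, symmetric] by blast

lemma homogeneous_mult:
  assumes "g \<in> carrier G" "h \<in> carrier G" "a \<in> homogeneous g" "b \<in> homogeneous h"
  shows "a \<otimes>\<^bsub>A\<^esub> b \<in> homogeneous (g \<otimes>\<^bsub>G\<^esub> h)"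
proof -
  obtain l m where lm: "l \<in> carrier F" "m \<in> carrier F"
      "a = l \<odot>\<^bsub>A\<^esub> basis_elt F g" "b = m \<odot>\<^bsub>A\<^esub> basis_elt F h"
    using assms by (auto simp: homogeneous_def)
  have t: "\<tau> g h \<in> carrier F" using \<tau> assms by auto
  have "a \<otimes>\<^bsub>A\<^esub> b = (m \<otimes> l \<otimes> \<tau> g h) \<odot>\<^bsub>A\<^esub> basis_elt F (g \<otimes>\<^bsub>G\<^esub> h)"
    using lm t assms by (simp add: smult_mult_left smult_mult_right basis_mult basis_closed
      smult_closed M.smult_assoc1)
  thus ?thesis using lm t by (auto simp: homogeneous_def)
qed

lemma one_homogeneous: "\<one>\<^bsub>A\<^esub> \<in> homogeneous \<one>\<^bsub>G\<^esub>"
proof -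
  have "inv (\<tau> \<one>\<^bsub>G\<^esub> \<one>\<^bsub>G\<^esub>) \<in> carrier F" using \<tau>[of "\<one>\<^bsub>G\<^esub>" "\<one>\<^bsub>G\<^esub>"] F.field_Units by auto
  moreover have "\<one>\<^bsub>A\<^esub> = inv (\<tau> \<one>\<^bsub>G\<^esub> \<one>\<^bsub>G\<^esub>) \<odot>\<^bsub>A\<^esub> basis_elt F \<one>\<^bsub>G\<^esub>" by (rule ext) (simp add: ops)
  ultimately show ?thesis by (auto simp: homogeneous_def)
qed

lemma basis_one_scalar: "basis_elt F \<one>\<^bsub>G\<^esub> = \<tau> \<one>\<^bsub>G\<^esub> \<one>\<^bsub>G\<^esub> \<odot>\<^bsub>A\<^esub> \<one>\<^bsub>A\<^esub>"
proof -
  have t: "\<tau> \<one>\<^bsub>G\<^esub> \<one>\<^bsub>G\<^esub> \<in> carrier F - {\<zero>}" by (rule \<tau>) auto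
  hence "inv (\<tau> \<one>\<^bsub>G\<^esub> \<one>\<^bsub>G\<^esub>) \<in> carrier F" "\<tau> \<one>\<^bsub>G\<^esub> \<one>\<^bsub>G\<^esub> \<otimes> inv (\<tau> \<one>\<^bsub>G\<^esub> \<one>\<^bsub>G\<^esub>) = \<one>"
    using F.field_Units by auto
  thus ?thesis using t
    by (intro ext) (simp add: ops F.m_assoc[symmetric], simp add: basis_elt_def)
qed

lemma homogeneous_one_scalar:
  assumes "a \<in> homogeneous \<one>\<^bsub>G\<^esub>"
  obtains l where "l \<in> carrier F" "a = l \<odot>\<^bsub>A\<^esub> \<one>\<^bsub>A\<^esub>"
proof -
  obtain m where m: "m \<in> carrier F" "a = m \<odot>\<^bsub>A\<^esub> basis_elt F \<one>\<^bsub>G\<^esub>"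
    using assms by (auto simp: homogeneous_def)
  have "\<tau> \<one>\<^bsub>G\<^esub> \<one>\<^bsub>G\<^esub> \<in> carrier F" using \<tau>[of "\<one>\<^bsub>G\<^esub>" "\<one>\<^bsub>G\<^esub>"] by auto
  with m show thesis
    by (intro that[of "m \<otimes> \<tau> \<one>\<^bsub>G\<^esub> \<one>\<^bsub>G\<^esub>"]) (auto simp: basis_one_scalar M.smult_assoc1)
qed

lemma homogeneous_pow:
  assumes "g \<in> carrier G" "a \<in> homogeneous g"
  shows "a [^]\<^bsub>A\<^esub> (n::nat) \<in> homogeneous (g [^]\<^bsub>G\<^esub> n)"
  by (induction n) (use assms in \<open>auto simp: one_homogeneous homogeneous_mult\<close>)

lemma basis_inverse:
  assumes g: "g \<in> carrier G"
  obtains v where "v \<in> homogeneous (inv\<^bsub>G\<^esub> g)"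
    "basis_elt F g \<otimes>\<^bsub>A\<^esub> v = \<one>\<^bsub>A\<^esub>" "v \<otimes>\<^bsub>A\<^esub> basis_elt F g = \<one>\<^bsub>A\<^esub>"
proof -
  let ?g' = "inv\<^bsub>G\<^esub> g"
  have scale: "inv (t \<otimes> \<tau> \<one>\<^bsub>G\<^esub> \<one>\<^bsub>G\<^esub>) \<in> carrier F"
      "inv (t \<otimes> \<tau> \<one>\<^bsub>G\<^esub> \<one>\<^bsub>G\<^esub>) \<odot>\<^bsub>A\<^esub> (t \<odot>\<^bsub>A\<^esub> basis_elt F \<one>\<^bsub>G\<^esub>) = \<one>\<^bsub>A\<^esub>"
    if t: "t \<in> carrier F - {\<zero>}" for t
  proof -
    let ?s = "t \<otimes> \<tau> \<one>\<^bsub>G\<^esub> \<one>\<^bsub>G\<^esub>"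
    have o: "\<tau> \<one>\<^bsub>G\<^esub> \<one>\<^bsub>G\<^esub> \<in> carrier F - {\<zero>}" by (rule \<tau>) auto
    have s: "?s \<in> carrier F" "?s \<noteq> \<zero>" using t o F.integral by auto
    hence i: "inv ?s \<in> carrier F" "inv ?s \<otimes> ?s = \<one>" using F.field_Units by auto
    show "inv ?s \<in> carrier F" by fact
    have "t \<odot>\<^bsub>A\<^esub> basis_elt F \<one>\<^bsub>G\<^esub> = ?s \<odot>\<^bsub>A\<^esub> \<one>\<^bsub>A\<^esub>"
      using t o by (simp add: basis_one_scalar M.smult_assoc1)
    thus "inv ?s \<odot>\<^bsub>A\<^esub> (t \<odot>\<^bsub>A\<^esub> basis_elt F \<one>\<^bsub>G\<^esub>) = \<one>\<^bsub>A\<^esub>"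
      using s i by (simp add: M.smult_assoc1[symmetric])
  qed
  define v where "v = inv (\<tau> g ?g' \<otimes> \<tau> \<one>\<^bsub>G\<^esub> \<one>\<^bsub>G\<^esub>) \<odot>\<^bsub>A\<^esub> basis_elt F ?g'"
  define v' where "v' = inv (\<tau> ?g' g \<otimes> \<tau> \<one>\<^bsub>G\<^esub> \<one>\<^bsub>G\<^esub>) \<odot>\<^bsub>A\<^esub> basis_elt F ?g'"
  have t: "\<tau> g ?g' \<in> carrier F - {\<zero>}" "\<tau> ?g' g \<in> carrier F - {\<zero>}"
    using g by (intro \<tau>; simp)+
  have hom: "v \<in> homogeneous ?g'" "v' \<in> homogeneous ?g'"
    using scale(1)[OF t(1)] scale(1)[OF t(2)] by (auto simp: v_def v'_def homogeneous_def)
  have right: "basis_elt F g \<otimes>\<^bsub>A\<^esub> v = \<one>\<^bsub>A\<^esub>"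
    using scale[OF t(1)] g by (simp add: v_def smult_mult_right basis_closed basis_mult)
  have left: "v' \<otimes>\<^bsub>A\<^esub> basis_elt F g = \<one>\<^bsub>A\<^esub>"
    using scale[OF t(2)] g by (simp add: v'_def smult_mult_left basis_closed basis_mult)
  have "v' = v"
    by (rule A.inv_unique[OF left right])
      (use g hom[THEN homogeneous_carrier[rotated]] in \<open>auto simp: basis_closed\<close>)
  thus thesis using that hom right left by blast
qed

text \<open>This is where characteristic 0 enters: the element \<open>e = w - 1\<close> satisfies \<open>n e = w\<^sup>n - 1\<close>,
  which is a scalar, so \<open>e\<close> is a scalar as soon as \<open>n\<close> is invertible in \<open>F\<close>.  A square-zero scalar
  vanishes.\<close>

lemma unipotent_torsion_trivial:
  assumes char: "char_zero F"
    and w: "w \<in> carrier A" and unip: "(w \<ominus>\<^bsub>A\<^esub> \<one>\<^bsub>A\<^esub>) \<otimes>\<^bsub>A\<^esub> (w \<ominus>\<^bsub>A\<^esub> \<one>\<^bsub>A\<^esub>) = \<zero>\<^bsub>A\<^esub>"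
    and n: "n > 0" and m: "m \<in> carrier F" "w [^]\<^bsub>A\<^esub> (n::nat) = m \<odot>\<^bsub>A\<^esub> \<one>\<^bsub>A\<^esub>"
  shows "w = \<one>\<^bsub>A\<^esub>"
proof -
  define e where "e = w \<ominus>\<^bsub>A\<^esub> \<one>\<^bsub>A\<^esub>"
  have e: "e \<in> carrier A" and sq: "e \<otimes>\<^bsub>A\<^esub> e = \<zero>\<^bsub>A\<^esub>" using w unip by (auto simp: e_def)
  have we: "w = \<one>\<^bsub>A\<^esub> \<oplus>\<^bsub>A\<^esub> e"
    using w by (simp add: e_def A.minus_eq A.a_lcomm[of "\<one>\<^bsub>A\<^esub>"] A.r_neg)
  have smult_nat: "[k] \<cdot>\<^bsub>A\<^esub> e = ([k] \<cdot> \<one>) \<odot>\<^bsub>A\<^esub> e" for k :: nat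
    by (induction k) (use e in \<open>auto simp: M.smult_l_distr M.smult_l_null\<close>)
  define q where "q = [n] \<cdot> \<one>"
  have q: "q \<in> carrier F" "q \<noteq> \<zero>" using char n by (auto simp: q_def char_zero_def)
  hence i: "inv q \<in> carrier F" "inv q \<otimes> q = \<one>" using F.field_Units by auto
  have "\<one>\<^bsub>A\<^esub> \<oplus>\<^bsub>A\<^esub> q \<odot>\<^bsub>A\<^esub> e = m \<odot>\<^bsub>A\<^esub> \<one>\<^bsub>A\<^esub>"
    using A.one_plus_square_zero_pow[OF e sq, of n] m by (simp add: we smult_nat q_def)
  moreover have "q \<odot>\<^bsub>A\<^esub> e = (\<one>\<^bsub>A\<^esub> \<oplus>\<^bsub>A\<^esub> q \<odot>\<^bsub>A\<^esub> e) \<ominus>\<^bsub>A\<^esub> \<one>\<^bsub>A\<^esub>"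
    using q e by (simp add: smult_closed A.minus_eq A.a_comm[of "\<one>\<^bsub>A\<^esub>"] A.a_assoc A.r_neg)
  ultimately have "q \<odot>\<^bsub>A\<^esub> e = m \<odot>\<^bsub>A\<^esub> \<one>\<^bsub>A\<^esub> \<ominus>\<^bsub>A\<^esub> \<one>\<^bsub>A\<^esub>" by simp
  also have "\<dots> = (m \<ominus> \<one>) \<odot>\<^bsub>A\<^esub> \<one>\<^bsub>A\<^esub>"
    using m by (simp add: A.minus_eq F.minus_eq M.smult_l_distr M.smult_l_minus)
  finally have qe: "q \<odot>\<^bsub>A\<^esub> e = (m \<ominus> \<one>) \<odot>\<^bsub>A\<^esub> \<one>\<^bsub>A\<^esub>" .
  define r where "r = inv q \<otimes> (m \<ominus> \<one>)"
  have r: "r \<in> carrier F" using i m by (simp add: r_def)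
  have "inv q \<odot>\<^bsub>A\<^esub> (q \<odot>\<^bsub>A\<^esub> e) = e" using i q e by (simp add: M.smult_assoc1[symmetric])
  hence er: "e = r \<odot>\<^bsub>A\<^esub> \<one>\<^bsub>A\<^esub>" using i m by (simp add: qe r_def M.smult_assoc1)
  have "r \<odot>\<^bsub>A\<^esub> e = (r \<odot>\<^bsub>A\<^esub> \<one>\<^bsub>A\<^esub>) \<otimes>\<^bsub>A\<^esub> e" using r e by (simp add: smult_mult_left)
  hence re: "r \<odot>\<^bsub>A\<^esub> e = \<zero>\<^bsub>A\<^esub>" using sq er by simp
  have "e = \<zero>\<^bsub>A\<^esub>"
  proof (cases "r = \<zero>")
    case True
    thus ?thesis using er by (simp add: M.smult_l_null)
  next
    case False
    hence "inv r \<in> carrier F" "inv r \<otimes> r = \<one>" using r F.field_Units by auto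
    thus ?thesis using re r e M.smult_assoc1[of "inv r" r e] by (simp add: M.smult_r_null)
  qed
  thus ?thesis by (simp add: we)
qed

lemma basis_commute:
  assumes char: "char_zero F" and lf: "locally_finite G"
    and central: "\<And>a b. a \<in> carrier A \<Longrightarrow> b \<in> carrier A \<Longrightarrow> additive_commutator A a b \<in> center A"
    and g: "g \<in> carrier G" and h: "h \<in> carrier G"
  shows "basis_elt F g \<otimes>\<^bsub>A\<^esub> basis_elt F h = basis_elt F h \<otimes>\<^bsub>A\<^esub> basis_elt F g"
proof -
  let ?x = "basis_elt F g" and ?y = "basis_elt F h"
  note [simp] = basis_closed[OF g] basis_closed[OF h]
  obtain x' where x': "x' \<in> homogeneous (inv\<^bsub>G\<^esub> g)" "?x \<otimes>\<^bsub>A\<^esub> x' = \<one>\<^bsub>A\<^esub>"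
      "x' \<otimes>\<^bsub>A\<^esub> ?x = \<one>\<^bsub>A\<^esub>"
    by (rule basis_inverse[OF g])
  obtain y' where y': "y' \<in> homogeneous (inv\<^bsub>G\<^esub> h)" "?y \<otimes>\<^bsub>A\<^esub> y' = \<one>\<^bsub>A\<^esub>"
      "y' \<otimes>\<^bsub>A\<^esub> ?y = \<one>\<^bsub>A\<^esub>"
    by (rule basis_inverse[OF h])
  have [simp]: "x' \<in> carrier A" "y' \<in> carrier A"
    using homogeneous_carrier[OF _ x'(1)] homogeneous_carrier[OF _ y'(1)] g h by auto
  define k where "k = g \<otimes>\<^bsub>G\<^esub> h \<otimes>\<^bsub>G\<^esub> (inv\<^bsub>G\<^esub> g \<otimes>\<^bsub>G\<^esub> inv\<^bsub>G\<^esub> h)"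
  define w where "w = ?x \<otimes>\<^bsub>A\<^esub> ?y \<otimes>\<^bsub>A\<^esub> (x' \<otimes>\<^bsub>A\<^esub> y')"
  have k: "k \<in> carrier G" using g h by (simp add: k_def)
  have hom: "w \<in> homogeneous k"
    unfolding w_def k_def using g h x' y' by (intro homogeneous_mult basis_homogeneous) auto
  have "?y \<otimes>\<^bsub>A\<^esub> ?x \<otimes>\<^bsub>A\<^esub> (x' \<otimes>\<^bsub>A\<^esub> y') = ?y \<otimes>\<^bsub>A\<^esub> (?x \<otimes>\<^bsub>A\<^esub> x') \<otimes>\<^bsub>A\<^esub> y'"
    by (simp add: A.m_assoc)
  hence inv: "?y \<otimes>\<^bsub>A\<^esub> ?x \<otimes>\<^bsub>A\<^esub> (x' \<otimes>\<^bsub>A\<^esub> y') = \<one>\<^bsub>A\<^esub>" using x' y' by simp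
  have unip: "(w \<ominus>\<^bsub>A\<^esub> \<one>\<^bsub>A\<^esub>) \<otimes>\<^bsub>A\<^esub> (w \<ominus>\<^bsub>A\<^esub> \<one>\<^bsub>A\<^esub>) = \<zero>\<^bsub>A\<^esub>"
    unfolding w_def using inv by (intro A.commutator_quotient_unipotent central) auto
  obtain n :: nat where n: "n > 0" "k [^]\<^bsub>G\<^esub> n = \<one>\<^bsub>G\<^esub>"
    by (rule G.locally_finite_torsion[OF lf k])
  have "w [^]\<^bsub>A\<^esub> n \<in> homogeneous \<one>\<^bsub>G\<^esub>" using homogeneous_pow[OF k hom, of n] n by simp
  then obtain m where m: "m \<in> carrier F" "w [^]\<^bsub>A\<^esub> n = m \<odot>\<^bsub>A\<^esub> \<one>\<^bsub>A\<^esub>"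
    by (rule homogeneous_one_scalar)
  have w1: "w = \<one>\<^bsub>A\<^esub>"
    by (rule unipotent_torsion_trivial[OF char homogeneous_carrier[OF k hom] unip n(1) m])
  \<comment> \<open>As \<open>x' y'\<close> is a two-sided inverse of \<open>y x\<close>, the equation \<open>w = 1\<close> can be multiplied by \<open>y x\<close>.\<close>
  have "?x \<otimes>\<^bsub>A\<^esub> ?y = ?x \<otimes>\<^bsub>A\<^esub> ?y \<otimes>\<^bsub>A\<^esub> (x' \<otimes>\<^bsub>A\<^esub> (y' \<otimes>\<^bsub>A\<^esub> ?y) \<otimes>\<^bsub>A\<^esub> ?x)"
    using x' y' by simp
  also have "\<dots> = w \<otimes>\<^bsub>A\<^esub> (?y \<otimes>\<^bsub>A\<^esub> ?x)" by (simp add: w_def A.m_assoc)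
  finally show ?thesis using w1 by simp
qed

lemma basis_induct [consumes 1, case_names zero add smult]:
  assumes a: "a \<in> carrier A"
    and zero: "P \<zero>\<^bsub>A\<^esub>"
    and add: "\<And>b c. b \<in> carrier A \<Longrightarrow> c \<in> carrier A \<Longrightarrow> P b \<Longrightarrow> P c \<Longrightarrow> P (b \<oplus>\<^bsub>A\<^esub> c)"
    and smult: "\<And>l g. l \<in> carrier F \<Longrightarrow> g \<in> carrier G \<Longrightarrow> P (l \<odot>\<^bsub>A\<^esub> basis_elt F g)"
  shows "P a"
proof -
  have "a \<in> carrier A \<Longrightarrow> supp F a = S \<Longrightarrow> P a" if "finite S" for S a
    using that
  proof (induction S arbitrary: a rule: finite_induct)
    case empty
    hence "a = \<zero>\<^bsub>A\<^esub>" by (auto simp: fun_eq_iff ops supp_def)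
    thus ?case using zero by simp
  next
    case (insert g S)
    note a = carrierD[OF insert.prems(1)]
    have g: "g \<in> carrier G" using a insert.prems by auto
    define b where "b = a(g := \<zero>)"
    have b: "b \<in> carrier A" by (rule carrierI[of _ "supp F a"]) (use a in \<open>auto simp: b_def supp_def\<close>)
    have "supp F b = S" using insert by (auto simp: b_def supp_def)
    hence Pb: "P b" using insert.IH b by simp
    have "a = b \<oplus>\<^bsub>A\<^esub> (a g \<odot>\<^bsub>A\<^esub> basis_elt F g)"
      using a by (auto simp: fun_eq_iff ops b_def basis_elt_def)
    thus ?case
      by (rule ssubst) (intro add b Pb smult smult_closed basis_closed a g)
  qed
  thus ?thesis using a carrierD(2)[OF a] by blast
qed

lemma commutative_if_basis_commutes:
  assumes comm: "\<And>g h. g \<in> carrier G \<Longrightarrow> h \<in> carrier G \<Longrightarrow>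
      basis_elt F g \<otimes>\<^bsub>A\<^esub> basis_elt F h = basis_elt F h \<otimes>\<^bsub>A\<^esub> basis_elt F g"
    and a: "a \<in> carrier A" and b: "b \<in> carrier A"
  shows "a \<otimes>\<^bsub>A\<^esub> b = b \<otimes>\<^bsub>A\<^esub> a"
proof -
  have basis: "basis_elt F g \<otimes>\<^bsub>A\<^esub> b = b \<otimes>\<^bsub>A\<^esub> basis_elt F g" if g: "g \<in> carrier G" for g
    using b
  proof (induction b rule: basis_induct)
    case zero
    show ?case using g by (simp add: basis_closed)
  next
    case (add b c)
    thus ?case using g by (simp only: basis_closed distrib)
  next
    case (smult l h)
    thus ?case using g by (simp only: basis_closed smult_mult_left smult_mult_right comm[OF g])
  qed
  show ?thesis
    using a
  proof (induction a rule: basis_induct)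
    case zero
    show ?case using b by simp
  next
    case (add c d)
    thus ?case using b by (simp only: distrib)
  next
    case (smult l g)
    thus ?case using b by (simp only: basis_closed smult_mult_left smult_mult_right basis)
  qed
qed

end

theorem corollary2p5:
  fixes F :: "('f, 'm) ring_scheme" and G :: "('g, 'n) monoid_scheme"
    and \<tau> :: "'g \<Rightarrow> 'g \<Rightarrow> 'f"
  assumes "field F" and "char_zero F"
    and "group G" and "locally_finite G"
    and "twisting_function F G \<tau>"
    and "\<forall>a\<in>carrier (twisted_group_algebra F G \<tau>). \<forall>b\<in>carrier (twisted_group_algebra F G \<tau>).
           additive_commutator (twisted_group_algebra F G \<tau>) a b
             \<in> center (twisted_group_algebra F G \<tau>)"
  shows "cring (twisted_group_algebra F G \<tau>)"
proof -
  interpret twisted_algebra F G \<tau>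
    using assms by (simp add: twisted_algebra_def twisted_algebra_axioms_def nonzero_twist_def
      nonzero_twist_axioms_def twisting_function_def)
  have central: "additive_commutator A a b \<in> center A" if "a \<in> carrier A" "b \<in> carrier A" for a b
    using assms(6) that by blast
  have "comm_monoid A"
  proof (rule A.monoid_comm_monoidI)
    show "a \<otimes>\<^bsub>A\<^esub> b = b \<otimes>\<^bsub>A\<^esub> a" if "a \<in> carrier A" "b \<in> carrier A" for a b
      by (rule commutative_if_basis_commutes[OF basis_commute[OF assms(2,4) central] that])
  qed
  with A.ring_axioms show ?thesis by (rule cring.intro)
qed

end
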